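(* Let $d\geq 1$ be an integer and let $$\mathcal{A}_d=\left\{\{x\in \mathbb{R}^d \ ; \ x^i\leq a\} \ ; \ i=1,\ldots,d,\ a\in \mathbb{R}\right\}.$$ Then $$VC(\mathcal{A}_d)=\max\left\{n \ ; \ \binom{n}{\lfloor n/2\rfloor}\leq d\right\},$$ where $\lfloor n/2\rfloor$ denotes the integer part of $n/2$ and $n$ ranges over the positive integers. Furthermore, for all $d\geq 3$, $$\log_2 d+\frac{\log_2 \pi-1}{2}\leq VC(\mathcal{A}_d)\leq \frac{3}{2}\log_2 d+0.63.$$
   Context: For $x\in\mathbb{R}^d$, $x^i$ denotes the $i$-th coordinate of $x$. Let $\mathcal{A}$ be a set of subsets of a space $\mathcal{X}$. A tuple $(x_1,\ldots,x_n)\in\mathcal{X}^n$ is shattered by $\mathcal{A}$ if $\left|\left\{\{x_1,\ldots,x_n\}\cap A \ ; \ A\in\mathcal{A}\right\}\right|=2^n$, i.e. every subset of $\{x_1,\ldots,x_n\}$ (with $x_1,\ldots,x_n$ necessarily distinct) is of the form $\{x_1,\ldots,x_n\}\cap A$ with $A\in\mathcal{A}$. The Vapnik-Chervonenkis dimension $VC(\mathcal{A})$ is the maximal integer $n$ such that there exist $n$ points in $\mathcal{X}$ shattered by $\mathcal{A}$: $$VC(\mathcal{A})=\max\left\{n \ ; \ \max_{(x_1,\ldots,x_n)\in\mathcal{X}^n}\left|\left\{\{x_1,\ldots,x_n\}\cap A \ ; \ A\in\mathcal{A}\right\}\right|=2^n\right\},$$ with $VC(\mathcal{A})=+\infty$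 if no such maximal integer exists. Here $\mathcal{X}=\mathbb{R}^d$. *)

theory Defs
  imports "HOL-Analysis.Analysis"
begin

text \<open>
  A tuple is a list. Since the traces are subsets of \<open>set xs\<close>, the cardinality
  condition forces \<open>xs\<close> to be distinct.
\<close>

definition shattered :: "'a set set \<Rightarrow> 'a list \<Rightarrow> bool" where
  "shattered \<A> xs \<longleftrightarrow> card {set xs \<inter> A | A. A \<in> \<A>} = 2 ^ length xs"

definition shattered_sizes :: "'a set set \<Rightarrow> nat set" where
  "shattered_sizes \<A> = {n. \<exists>xs. length xs = n \<and> shattered \<A> xs}"

text \<open>
  The size \<open>0\<close> is admitted: the empty tuple is shattered by every nonempty class.
  The empty class shatters nothing, so the maximum does not exist and the dimension
  is \<open>\<infinity>\<close>, following the convention for a missing maximum.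
\<close>

definition VC :: "'a set set \<Rightarrow> enat" where
  "VC \<A> = (if finite (shattered_sizes \<A>) \<and> shattered_sizes \<A> \<noteq> {}
           then enat (Max (shattered_sizes \<A>)) else \<infinity>)"

definition axis_halfspaces :: "(real ^ 'd) set set" where
  "axis_halfspaces = {{x. x $ i \<le> a} | i a. True}"

text \<open>
  \<open>Max\<close> is only meaningful on finite nonempty sets; this covers the one in the theorem.
\<close>

lemma central_binomial_le_finite_nonempty:
  assumes "d \<ge> 1"
  shows "finite {n::nat. n \<ge> 1 \<and> n choose (n div 2) \<le> d}"
    and "{n::nat. n \<ge> 1 \<and> n choose (n div 2) \<le> d} \<noteq> {}"
proof -
  have "n \<le> d" if "n choose (n div 2) \<le> d" for n :: nat
    using binomial_maximum[of n 1] that by simp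
  then have "{n::nat. n \<ge> 1 \<and> n choose (n div 2) \<le> d} \<subseteq> {..d}"
    by blast
  then show "finite {n::nat. n \<ge> 1 \<and> n choose (n div 2) \<le> d}"
    by (rule finite_subset) simp
  have "1 \<in> {n::nat. n \<ge> 1 \<and> n choose (n div 2) \<le> d}"
    using assms by simp
  then show "{n::nat. n \<ge> 1 \<and> n choose (n div 2) \<le> d} \<noteq> {}"
    by blast
qed

end

theory Submission imports Defs begin

text \<open>
  The traces of the half-spaces in a fixed direction \<open>i\<close> form a chain. A set of \<open>n\<close> points is
  therefore shattered by the \<open>d\<close> directions only if its power set is a union of \<open>d\<close> chains;
  conversely, every chain is realised by a suitable choice of the \<open>i\<close>-th coordinates.
  A chain contains at most one subset of size \<open>\<lfloor>n/2\<rfloor>\<close>, so \<open>n choose \<lfloor>n/2\<rfloor>\<close> chains are necessary,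
  and de Bruijn's decomposition into symmetric chains shows that as many suffice.
  The lower estimate is Wallis' product: \<open>(4^k / (2k choose k))\<^sup>2 / k\<close> decreases to \<open>\<pi>\<close>.
  For the upper one, the central binomial coefficient gains a factor of at least \<open>3 > 2 powr (4/3)\<close>
  whenever \<open>n\<close> grows by \<open>2\<close>.
\<close>

section \<open>Symmetric chains\<close>

text \<open>
  The smallest element of the symmetric chain of \<open>T\<close> in the decomposition of the subsets of \<open>{..<n}\<close>.
  The chain with bottom \<open>B\<close> consists of one set of each size from \<open>card B\<close> to \<open>n - card B\<close>. It
  gives rise to two chains for \<open>n + 1\<close>: itself extended by its top with \<open>n\<close> added, and its
  elements other than the top with \<open>n\<close> added.
\<close>

fun chain_bottom :: "nat \<Rightarrow> nat set \<Rightarrow> nat set" where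
  "chain_bottom 0 T = {}"
| "chain_bottom (Suc n) T =
     (let B = chain_bottom n (T - {n})
      in if n \<notin> T \<or> card (T - {n}) + card B = n then B else insert n B)"

lemma chain_bottom_subset: "T \<subseteq> {..<n} \<Longrightarrow> chain_bottom n T \<subseteq> T"
proof (induction n arbitrary: T)
  case (Suc n)
  have "T - {n} \<subseteq> {..<n}" using Suc.prems by (auto simp: less_Suc_eq)
  from Suc.IH[OF this] show ?case by (auto simp: Let_def)
qed simp

text \<open>Equality characterises the top of a chain, which is what the test in
  \<open>chain_bottom\<close> detects. A set below the top leaves a slack of one, which pays for
  \<open>n\<close> entering both the set and its bottom.\<close>

lemma card_add_card_chain_bottom_le:
  "T \<subseteq> {..<n} \<Longrightarrow> card T + card (chain_bottom n T) \<le> n"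
proof (induction n arbitrary: T)
  case (Suc n)
  define S where "S = T - {n}"
  have S: "S \<subseteq> {..<n}" using Suc.prems by (auto simp: less_Suc_eq S_def)
  have fin: "finite S" using S finite_subset by blast
  have finB: "finite (chain_bottom n S)"
    using chain_bottom_subset[OF S] fin finite_subset by blast
  have nB: "n \<notin> chain_bottom n S" using chain_bottom_subset[OF S] S by auto
  have "card T \<le> Suc (card S)" "n \<notin> T \<Longrightarrow> card T = card S"
    using card_Suc_Diff1[of T n] Suc.prems finite_subset[of T "{..<Suc n}"]
    by (cases "n \<in> T"; simp add: S_def)+
  then show ?case using Suc.IH[OF S] finB nB by (auto simp: Let_def simp flip: S_def)
qed simp

lemma chain_bottom_Suc_not_mem:
  "T \<subseteq> {..<n} \<Longrightarrow> chain_bottom (Suc n) T = chain_bottom n T"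
  by (subgoal_tac "n \<notin> T") (auto simp: Let_def)

lemma chain_bottom_Suc_insert:
  "T \<subseteq> {..<n} \<Longrightarrow> chain_bottom (Suc n) (insert n T) =
    (if card T + card (chain_bottom n T) = n then chain_bottom n T else insert n (chain_bottom n T))"
  by (subgoal_tac "n \<notin> T") (auto simp: Let_def)

lemma subset_lessThan_Suc_cases:
  assumes "T \<subseteq> {..<Suc n}"
  obtains (old) "T \<subseteq> {..<n}" | (new) S where "S \<subseteq> {..<n}" "T = insert n S"
proof (cases "n \<in> T")
  case True
  then have "T - {n} \<subseteq> {..<n}" "T = insert n (T - {n})" using assms by (auto simp: less_Suc_eq)
  then show ?thesis by (rule new)
next
  case False
  then have "T \<subseteq> {..<n}" using assms by (auto simp: less_Suc_eq)
  then show ?thesis by (rule old)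
qed

lemma card_insert_lessThan: "T \<subseteq> {..<n::nat} \<Longrightarrow> card (insert n T) = Suc (card T)"
  using finite_subset[OF _ finite_lessThan, of T n] by (auto simp: card_insert_if)

text \<open>The delicate case is that only one of the two sets contains \<open>n\<close>. The common
  bottom does not contain \<open>n\<close>, so that set is the top of an old chain with
  \<open>n\<close> added, and it lies above everything else in the extended chain.\<close>

lemma chain_bottom_chain:
  assumes "S \<subseteq> {..<n}" "T \<subseteq> {..<n}" "chain_bottom n S = chain_bottom n T" "card S \<le> card T"
  shows "S \<subseteq> T"
  using assms
proof (induction n arbitrary: S T)
  case (Suc n)
  note IH = Suc.IH and eq = Suc.prems(3) and le = Suc.prems(4)
  have notin: "n \<notin> chain_bottom n U" if "U \<subseteq> {..<n}" for U
    using chain_bottom_subset[OF that] that by auto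
  from Suc.prems(1) show ?case
  proof (cases rule: subset_lessThan_Suc_cases)
    case S: old
    from Suc.prems(2) show ?thesis
    proof (cases rule: subset_lessThan_Suc_cases)
      case old
      with S eq le IH show ?thesis by (simp only: chain_bottom_Suc_not_mem)
    next
      case (new T')
      have "chain_bottom n S = chain_bottom n T'" "card T' + card (chain_bottom n T') = n"
        using eq notin[OF S] new S
        by (simp_all only: chain_bottom_Suc_not_mem chain_bottom_Suc_insert split: if_splits) auto
      then show ?thesis
        using IH[OF S new(1)] card_add_card_chain_bottom_le[OF S] new(2) by auto
    qed
  next
    case S: (new S')
    from Suc.prems(2) show ?thesis
    proof (cases rule: subset_lessThan_Suc_cases)
      case old
      have "chain_bottom n S' = chain_bottom n T" "card S' + card (chain_bottom n S') = n"
        using eq notin[OF old] S old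
        by (simp_all only: chain_bottom_Suc_not_mem chain_bottom_Suc_insert split: if_splits) auto
      \<comment> \<open>Here \<open>S'\<close> is the top of the chain of \<open>T\<close>, so
        \<open>S\<close> is larger than any set in it, against
        \<open>card S \<le> card T\<close>.\<close>
      then show ?thesis
        using le card_add_card_chain_bottom_le[OF old] card_insert_lessThan[OF S(1)] S(2) by simp
    next
      case (new T')
      have "chain_bottom n S' = chain_bottom n T'"
        using eq notin[OF S(1)] notin[OF new(1)]
        unfolding S(2) new(2) chain_bottom_Suc_insert[OF S(1)] chain_bottom_Suc_insert[OF new(1)]
        by (auto split: if_splits)
      then show ?thesis
        using IH[OF S(1) new(1)] le card_insert_lessThan[OF S(1)] card_insert_lessThan[OF new(1)]
          S(2) new(2) by auto
    qed
  qed
qed simp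

text \<open>Chains skip no size. Hence each of them meets the middle layer, which is how the chains
  are counted.\<close>

lemma chain_bottom_level:
  assumes "T \<subseteq> {..<n}" "card (chain_bottom n T) \<le> k" "k + card (chain_bottom n T) \<le> n"
  shows "\<exists>S \<subseteq> {..<n}. chain_bottom n S = chain_bottom n T \<and> card S = k"
  using assms
proof (induction n arbitrary: T k)
  case (Suc n)
  \<comment> \<open>The extended chain serves twice: for \<open>T\<close> without \<open>n\<close>,
    and for \<open>T\<close> an old top with \<open>n\<close> added.\<close>
  have extended: "\<exists>S \<subseteq> {..<Suc n}. chain_bottom (Suc n) S = chain_bottom n U \<and> card S = k"
    if U: "U \<subseteq> {..<n}" "card (chain_bottom n U) \<le> k" "k + card (chain_bottom n U) \<le> Suc n" for U
  proof (cases "k + card (chain_bottom n U) = Suc n")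
    case False
    then obtain S where "S \<subseteq> {..<n}" "chain_bottom n S = chain_bottom n U" "card S = k"
      using Suc.IH[OF U(1,2)] U(3) by auto
    then show ?thesis
      using chain_bottom_Suc_not_mem[of S n] by (intro exI[of _ S]) auto
  next
    case True
    \<comment> \<open>The new largest size is attained only by the old top with \<open>n\<close>
      added.\<close>
    have "card (chain_bottom n U) \<le> card U"
      using chain_bottom_subset[OF U(1)] U(1) by (meson card_mono finite_lessThan finite_subset)
    then have "card (chain_bottom n U) \<le> k - 1" "k - 1 + card (chain_bottom n U) = n"
      using True card_add_card_chain_bottom_le[OF U(1)] by auto
    then obtain S where "S \<subseteq> {..<n}" "chain_bottom n S = chain_bottom n U" "card S = k - 1"
      using Suc.IH[OF U(1), of "k - 1"] by auto
    with \<open>k - 1 + card (chain_bottom n U) = n\<close> show ?thesis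
      using chain_bottom_Suc_insert[of S n] card_insert_lessThan[of S n] True
        card_add_card_chain_bottom_le[OF U(1)]
      by (intro exI[of _ "insert n S"]) (auto simp del: chain_bottom.simps)
  qed
  from Suc.prems(1) show ?case
  proof (cases rule: subset_lessThan_Suc_cases)
    case old
    then show ?thesis
      using extended[OF old] Suc.prems by (simp only: chain_bottom_Suc_not_mem)
  next
    case (new U)
    show ?thesis
    proof (cases "card U + card (chain_bottom n U) = n")
      case True
      then have "chain_bottom (Suc n) T = chain_bottom n U"
        using new chain_bottom_Suc_insert by auto
      then show ?thesis using extended[OF new(1)] Suc.prems by simp
    next
      case False
      have B: "chain_bottom (Suc n) T = insert n (chain_bottom n U)"
        using new chain_bottom_Suc_insert False by auto
      have "card (insert n (chain_bottom n U)) = Suc (card (chain_bottom n U))"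
        using card_insert_lessThan chain_bottom_subset[OF new(1)] new(1) by blast
      \<comment> \<open>The strict inequality keeps the set of size \<open>k - 1\<close> below the
        old top, so that adding \<open>n\<close> leads into the second chain.\<close>
      then have k: "card (chain_bottom n U) \<le> k - 1" "k - 1 + card (chain_bottom n U) < n" "k > 0"
        using Suc.prems(2,3) unfolding B by linarith+
      then obtain S where "S \<subseteq> {..<n}" "chain_bottom n S = chain_bottom n U" "card S = k - 1"
        using Suc.IH[OF new(1), of "k - 1"] by auto
      then show ?thesis
        using chain_bottom_Suc_insert[of S n] card_insert_lessThan[of S n] k B
        by (intro exI[of _ "insert n S"]) (auto simp del: chain_bottom.simps)
    qed
  qed
qed simp

text \<open>The sizes in a chain range symmetrically around \<open>n / 2\<close>, so every bottom is
  already the bottom of a set of size \<open>n div 2\<close>.\<close>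

lemma card_chain_bottom_image_le:
  "card (chain_bottom n ` Pow {..<n}) \<le> n choose (n div 2)"
proof -
  let ?M = "{T. T \<subseteq> {..<n} \<and> card T = n div 2}"
  have "chain_bottom n ` Pow {..<n} \<subseteq> chain_bottom n ` ?M"
  proof
    fix B assume "B \<in> chain_bottom n ` Pow {..<n}"
    then obtain T where T: "T \<subseteq> {..<n}" "B = chain_bottom n T" by auto
    have "card (chain_bottom n T) \<le> card T"
      using chain_bottom_subset[OF T(1)] T(1) by (meson card_mono finite_lessThan finite_subset)
    then have "2 * card (chain_bottom n T) \<le> n"
      using card_add_card_chain_bottom_le[OF T(1)] by linarith
    then have "card (chain_bottom n T) \<le> n div 2" "n div 2 + card (chain_bottom n T) \<le> n"
      by linarith+
    then show "B \<in> chain_bottom n ` ?M"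
      using chain_bottom_level[OF T(1), of "n div 2"] T(2) by (metis (mono_tags, lifting) imageI mem_Collect_eq)
  qed
  then have "card (chain_bottom n ` Pow {..<n}) \<le> card (chain_bottom n ` ?M)"
    by (intro card_mono) auto
  also have "\<dots> \<le> card ?M" by (intro card_image_le) simp
  also have "\<dots> = n choose (n div 2)" using n_subsets[of "{..<n}" "n div 2"] by simp
  finally show ?thesis .
qed

text \<open>Distinct chains receive distinct directions, so sets with the same direction share a
  chain.\<close>

lemma ex_chain_labelling:
  assumes "n choose (n div 2) \<le> CARD('d::finite)"
  obtains f :: "nat set \<Rightarrow> 'd::finite"
  where "\<And>S T. S \<subseteq> {..<n} \<Longrightarrow> T \<subseteq> {..<n} \<Longrightarrow> f S = f T \<Longrightarrow> S \<subseteq> T \<or> T \<subseteq> S"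
proof -
  have "card (chain_bottom n ` Pow {..<n}) \<le> card (UNIV :: 'd set)"
    using card_chain_bottom_image_le assms by (rule order_trans)
  then obtain g :: "nat set \<Rightarrow> 'd" where g: "inj_on g (chain_bottom n ` Pow {..<n})"
    by (metis card_le_inj finite_Pow_iff finite_code finite_imageI finite_lessThan)
  show thesis
  proof (rule that[of "g \<circ> chain_bottom n"])
    fix S T assume ST: "S \<subseteq> {..<n}" "T \<subseteq> {..<n}" "(g \<circ> chain_bottom n) S = (g \<circ> chain_bottom n) T"
    have eq: "chain_bottom n S = chain_bottom n T"
      by (rule inj_onD[OF g]) (use ST in simp_all)
    show "S \<subseteq> T \<or> T \<subseteq> S"
    proof (cases "card S \<le> card T")
      case True
      then show ?thesis using chain_bottom_chain[OF ST(1,2) eq] by blast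
    next
      case False
      then show ?thesis using chain_bottom_chain[OF ST(2,1) eq[symmetric]] by simp
    qed
  qed
qed

section \<open>Shattering by axis-parallel half-spaces\<close>

text \<open>The traces lie in \<open>Pow (set xs)\<close>, which has at most
  \<open>2 ^ length xs\<close> elements. Attaining this number forces both distinctness and all
  subsets as traces.\<close>

lemma shattered_iff:
  "shattered \<A> xs \<longleftrightarrow> distinct xs \<and> (\<forall>T \<subseteq> set xs. \<exists>A\<in>\<A>. set xs \<inter> A = T)"
proof -
  let ?tr = "{set xs \<inter> A | A. A \<in> \<A>}"
  have sub: "?tr \<subseteq> Pow (set xs)" by auto
  have cP: "card (Pow (set xs)) = 2 ^ card (set xs)" by (simp add: card_Pow)
  have "shattered \<A> xs \<longleftrightarrow> distinct xs \<and> ?tr = Pow (set xs)"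
  proof
    assume sh: "shattered \<A> xs"
    then have "(2::nat) ^ length xs \<le> 2 ^ card (set xs)"
      using card_mono[OF _ sub] cP by (simp add: shattered_def)
    then have "card (set xs) = length xs" using card_length[of xs] by simp
    then show "distinct xs \<and> ?tr = Pow (set xs)"
      using sh card_subset_eq[OF _ sub] cP by (simp add: shattered_def card_distinct)
  next
    assume "distinct xs \<and> ?tr = Pow (set xs)"
    then show "shattered \<A> xs" using cP by (simp add: shattered_def distinct_card)
  qed
  moreover have "?tr = Pow (set xs) \<longleftrightarrow> (\<forall>T \<subseteq> set xs. \<exists>A\<in>\<A>. set xs \<inter> A = T)"
  proof
    assume "?tr = Pow (set xs)"
    then have "T \<in> ?tr" if "T \<subseteq> set xs" for T using that by simp
    then show "\<forall>T \<subseteq> set xs. \<exists>A\<in>\<A>. set xs \<inter> A = T" by blast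
  next
    assume "\<forall>T \<subseteq> set xs. \<exists>A\<in>\<A>. set xs \<inter> A = T"
    then have "T \<in> ?tr" if "T \<subseteq> set xs" for T using that by blast
    then have "Pow (set xs) \<subseteq> ?tr" by (simp only: subset_iff Pow_iff) simp
    with sub show "?tr = Pow (set xs)" by (rule subset_antisym)
  qed
  ultimately show ?thesis by (simp only:)
qed

text \<open>Two traces cut out in the same direction are nested. Nested sets of equal size coincide,
  so the direction is injective on the middle layer.\<close>

lemma choose_le_of_shattered:
  fixes xs :: "(real ^ 'd) list"
  assumes "shattered axis_halfspaces xs"
  shows "length xs choose (length xs div 2) \<le> CARD('d)"
proof -
  let ?M = "{T. T \<subseteq> set xs \<and> card T = length xs div 2}"
  have "\<exists>p. set xs \<inter> {x. x $ fst p \<le> snd p} = T" if "T \<in> Pow (set xs)" for T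
  proof -
    have "T \<subseteq> set xs" using that by simp
    then obtain A where A: "A \<in> axis_halfspaces" "set xs \<inter> A = T"
      using conjunct2[OF iffD1[OF shattered_iff assms]] by (elim allE impE bexE)
    then obtain i a where "A = {x. x $ i \<le> a}" unfolding axis_halfspaces_def by blast
    then show ?thesis using A(2) by (intro exI[of _ "(i, a)"]) simp
  qed
  then obtain p where "\<forall>T \<in> Pow (set xs). set xs \<inter> {x. x $ fst (p T) \<le> snd (p T)} = T"
    using bchoice[of "Pow (set xs)"] by meson
  then obtain dir thr
    where dir: "\<And>T. T \<subseteq> set xs \<Longrightarrow> set xs \<inter> {x. x $ dir T \<le> thr T} = T"
    using that[of "\<lambda>T. fst (p T)" "\<lambda>T. snd (p T)"] by blast
  have "inj_on dir ?M"
  proof (rule inj_onI)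
    fix S T assume ST: "S \<in> ?M" "T \<in> ?M" "dir S = dir T"
    have eqs: "set xs \<inter> {x. x $ dir S \<le> thr S} = S" "set xs \<inter> {x. x $ dir T \<le> thr T} = T"
      using dir ST(1,2) by blast+
    have "S \<subseteq> T \<or> T \<subseteq> S"
    proof (cases "thr S \<le> thr T")
      case True
      then have "set xs \<inter> {x. x $ dir S \<le> thr S} \<subseteq> set xs \<inter> {x. x $ dir T \<le> thr T}"
        using ST(3) by auto
      then show ?thesis unfolding eqs by (rule disjI1)
    next
      case False
      then have "set xs \<inter> {x. x $ dir T \<le> thr T} \<subseteq> set xs \<inter> {x. x $ dir S \<le> thr S}"
        using ST(3) by auto
      then show ?thesis unfolding eqs by (rule disjI2)
    qed
    moreover have "finite S" "finite T" "card S = card T"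
      using ST(1,2) finite_subset by auto
    ultimately show "S = T" by (metis card_subset_eq)
  qed
  then have "card ?M \<le> CARD('d)" by (intro card_inj_on_le[of dir]) auto
  moreover have "card ?M = card (set xs) choose (length xs div 2)"
    using n_subsets[of "set xs" "length xs div 2"] by simp
  moreover have "card (set xs) = length xs"
    using assms by (simp add: shattered_iff distinct_card)
  ultimately show ?thesis by simp
qed

text \<open>
  The \<open>i\<close>-th coordinate of the \<open>k\<close>-th point is the position at which \<open>k\<close> enters the \<open>i\<close>-th chain.
\<close>

lemma ex_shattered_of_choose_le:
  assumes "n choose (n div 2) \<le> CARD('d::finite)"
  shows "\<exists>xs :: (real ^ 'd::finite) list. length xs = n \<and> shattered axis_halfspaces xs"
proof -
  obtain f :: "nat set \<Rightarrow> 'd"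
    where f: "\<And>S T. S \<subseteq> {..<n} \<Longrightarrow> T \<subseteq> {..<n} \<Longrightarrow> f S = f T \<Longrightarrow> S \<subseteq> T \<or> T \<subseteq> S"
    using ex_chain_labelling[OF assms] by metis
  define p :: "nat \<Rightarrow> real ^ 'd"
    where "p k = (\<chi> i. real (card {S. S \<subseteq> {..<n} \<and> f S = i \<and> k \<notin> S}))" for k
  \<comment> \<open>The members of a chain that lack \<open>k\<close> form an initial segment, and
    \<open>thr T\<close> is the number of members before \<open>T\<close>. So \<open>k\<close> has
    entered by \<open>T\<close> exactly if its coordinate is at most \<open>thr T\<close>.\<close>
  define thr where "thr T = real (card {S. S \<subset> T \<and> f S = f T})" for T
  have p: "p k $ f T \<le> thr T \<longleftrightarrow> k \<in> T" if T: "T \<subseteq> {..<n}" for T k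
  proof
    assume "k \<in> T"
    then have "{S. S \<subseteq> {..<n} \<and> f S = f T \<and> k \<notin> S} \<subseteq> {S. S \<subset> T \<and> f S = f T}"
      using f T by blast
    moreover have "finite {S. S \<subset> T \<and> f S = f T}"
      by (rule finite_subset[of _ "Pow {..<n}"]) (use T in auto)
    ultimately show "p k $ f T \<le> thr T"
      by (simp add: p_def thr_def card_mono)
  next
    assume le: "p k $ f T \<le> thr T"
    show "k \<in> T"
    proof (rule ccontr)
      assume "k \<notin> T"
      \<comment> \<open>The inclusion is strict because \<open>T\<close> itself lacks
        \<open>k\<close>.\<close>
      then have "{S. S \<subset> T \<and> f S = f T} \<subset> {S. S \<subseteq> {..<n} \<and> f S = f T \<and> k \<notin> S}"
        using T by blast
      then have "card {S. S \<subset> T \<and> f S = f T} < card {S. S \<subseteq> {..<n} \<and> f S = f T \<and> k \<notin> S}"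
        by (intro psubset_card_mono) auto
      then show False using le by (simp add: p_def thr_def)
    qed
  qed
  define xs where "xs = map p [0..<n]"
  have set_xs: "set xs = p ` {..<n}" by (auto simp: xs_def)
  have "inj_on p {..<n}"
  proof (rule inj_onI)
    fix k l assume "k \<in> {..<n}" "p k = p l"
    then have k: "{k} \<subseteq> {..<n}" and eq: "p k = p l" by simp_all
    have "p k $ f {k} \<le> thr {k}" using p[OF k] by blast
    then have "l \<in> {k}" unfolding eq p[OF k] .
    then show "k = l" by simp
  qed
  then have "distinct xs" by (simp add: xs_def distinct_map atLeast0LessThan)
  moreover have "\<exists>A\<in>axis_halfspaces. set xs \<inter> A = U" if "U \<subseteq> set xs" for U
  proof -
    obtain T where T: "T \<subseteq> {..<n}" "U = p ` T"
      using \<open>U \<subseteq> set xs\<close> unfolding set_xs by (meson subset_imageE)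
    have "set xs \<inter> {x. x $ f T \<le> thr T} = U"
      using p[OF T(1)] T unfolding set_xs by auto
    then show ?thesis by (auto simp: axis_halfspaces_def)
  qed
  ultimately have "shattered axis_halfspaces xs" by (simp add: shattered_iff)
  moreover have "length xs = n" by (simp add: xs_def)
  ultimately show ?thesis by blast
qed

lemma VC_axis_halfspaces:
  "VC (axis_halfspaces :: (real ^ 'd) set set)
     = enat (Max {n::nat. n \<ge> 1 \<and> n choose (n div 2) \<le> CARD('d)})"
proof -
  let ?S = "{n::nat. n \<ge> 1 \<and> n choose (n div 2) \<le> CARD('d)}"
  have d: "CARD('d) \<ge> 1" by (simp add: Suc_le_eq)
  note S = central_binomial_le_finite_nonempty[OF d]
  have "shattered_sizes (axis_halfspaces :: (real ^ 'd) set set)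
      = {n. n choose (n div 2) \<le> CARD('d)}"
    unfolding shattered_sizes_def
    using choose_le_of_shattered ex_shattered_of_choose_le by blast
  \<comment> \<open>The size \<open>0\<close> is shattered but outside the range of the theorem; it
    does not affect the maximum, as \<open>?S\<close> is nonempty.\<close>
  also have "\<dots> = insert 0 ?S"
    using d by (auto simp: Suc_le_eq)
  finally show ?thesis using S by (simp add: VC_def)
qed

section \<open>Estimates of the central binomial coefficient\<close>

lemma central_binomial_Suc:
  "Suc k * (2 * Suc k choose Suc k) = 2 * (2 * k + 1) * (2 * k choose k)"
proof -
  have "Suc k * (2 * Suc k choose Suc k) = 2 * (Suc k * (Suc (2 * k) choose k))"
    using Suc_times_binomial[of k "Suc (2 * k)"] by simp
  also have "Suc (2 * k) choose k = Suc (2 * k) choose Suc k"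
    using binomial_symmetric[of k "Suc (2 * k)"] by simp
  also have "Suc k * \<dots> = Suc (2 * k) * (2 * k choose k)"
    by (rule Suc_times_binomial)
  finally show ?thesis by simp
qed

lemma central_binomial_Suc_real:
  "real (2 * Suc k choose Suc k) = 2 * (2 * real k + 1) * real (2 * k choose k) / (real k + 1)"
  using arg_cong[OF central_binomial_Suc[of k], of real] by (simp add: field_simps)

lemma two_times_odd_central_binomial:
  "2 * (Suc (2 * k) choose k) = 2 * Suc k choose Suc k"
  using binomial_symmetric[of k "Suc (2 * k)"] by simp

text \<open>Turns the limit \<pi>/2 of the Wallis products into one for central binomial
  coefficients.\<close>

lemma wallis_central_binomial:
  "(\<Prod>j=1..k. (4 * real j ^ 2) / (4 * real j ^ 2 - 1))
     = (4 ^ k / real (2 * k choose k)) ^ 2 / (2 * real k + 1)"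
proof (induction k)
  case (Suc k)
  have nz: "real (2 * k choose k) \<noteq> 0" by simp
  have "4 * real (Suc k) ^ 2 - 1 = (2 * real k + 1) * (2 * real k + 3)"
    by (simp add: power2_eq_square algebra_simps)
  then have "(\<Prod>j=1..Suc k. (4 * real j ^ 2) / (4 * real j ^ 2 - 1))
     = (4 ^ k / real (2 * k choose k)) ^ 2 / (2 * real k + 1)
       * (4 * (real k + 1) ^ 2 / ((2 * real k + 1) * (2 * real k + 3)))"
    using Suc.IH by (simp add: algebra_simps)
  also have "\<dots> = (4 ^ Suc k / (2 * (2 * real k + 1) * real (2 * k choose k) / (real k + 1))) ^ 2
       / (2 * real (Suc k) + 1)"
    using nz by (simp add: divide_simps power2_eq_square add_nonneg_eq_0_iff) (simp add: algebra_simps)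
  finally show ?case unfolding central_binomial_Suc_real .
qed simp

lemma even_central_binomial_le:
  assumes "k \<ge> 1"
  shows "real (2 * k choose k) ^ 2 * pi * real k \<le> 16 ^ k"
proof -
  \<comment> \<open>The index is shifted by one to avoid the division by zero at
    \<open>k = 0\<close>.\<close>
  define a where "a j = (4 ^ Suc j / real (2 * Suc j choose Suc j)) ^ 2 / real (Suc j)" for j
  have "decseq a"
  proof (rule decseq_SucI)
    fix j
    define c where "c = real (2 * Suc j choose Suc j)"
    define t where "t = real (Suc j)"
    have ct: "c > 0" "t > 0" by (simp_all add: c_def t_def del: binomial_Suc_Suc)
    have "a (Suc j) = (4 ^ Suc (Suc j) / (2 * (2 * t + 1) * c / (t + 1))) ^ 2 / (t + 1)"
      unfolding a_def central_binomial_Suc_real[of "Suc j"] c_def t_def by simp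
    also have "\<dots> = (4 ^ Suc j / c) ^ 2 * (4 * (t + 1) / (2 * t + 1) ^ 2)"
      using ct by (simp add: divide_simps power2_eq_square) (simp add: algebra_simps)
    also have "\<dots> \<le> (4 ^ Suc j / c) ^ 2 * (1 / t)"
    proof (rule mult_left_mono)
      have "4 * (t + 1) * t \<le> (2 * t + 1) ^ 2"
        by (simp add: power2_eq_square algebra_simps)
      then show "4 * (t + 1) / (2 * t + 1) ^ 2 \<le> 1 / t"
        using ct by (simp add: pos_le_divide_eq)
    qed simp
    also have "\<dots> = a j" by (simp add: a_def c_def t_def)
    finally show "a (Suc j) \<le> a j" .
  qed
  moreover have "a \<longlonglongrightarrow> pi"
  proof -
    \<comment> \<open>With \<open>k = Suc j\<close>, the extra factor is
      \<open>(2 * k + 1) / k\<close>; it replaces the Wallis denominator \<open>2 * k + 1\<close> by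
      \<open>k\<close>.\<close>
    have "(\<lambda>j. (\<Prod>i=1..Suc j. (4 * real i ^ 2) / (4 * real i ^ 2 - 1)) * (2 + 1 / real (Suc j)))
        \<longlonglongrightarrow> pi / 2 * (2 + 0)"
      by (intro tendsto_intros LIMSEQ_Suc[OF wallis] LIMSEQ_Suc[OF lim_1_over_n])
    moreover have "(\<Prod>i=1..Suc j. (4 * real i ^ 2) / (4 * real i ^ 2 - 1)) * (2 + 1 / real (Suc j))
        = a j" for j
      unfolding wallis_central_binomial a_def by (simp add: divide_simps add_nonneg_eq_0_iff)
    ultimately show ?thesis by simp
  qed
  ultimately have "pi \<le> a (k - 1)" by (rule decseq_ge)
  also have "a (k - 1) = 16 ^ k / (real (2 * k choose k) ^ 2 * real k)"
    using assms by (simp add: a_def power_divide power2_eq_square flip: power_mult_distrib)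
  finally show ?thesis
    using assms by (simp add: pos_le_divide_eq algebra_simps)
qed

text \<open>The odd case follows from the next even one, whose central coefficient is exactly twice
  as large.\<close>

lemma central_binomial_upper_bound:
  assumes "n \<ge> 1"
  shows "real (n choose (n div 2)) ^ 2 * pi * real n \<le> 2 * 4 ^ n"
proof (cases "even n")
  case True
  then obtain k where k: "n = 2 * k" by blast
  then show ?thesis
    using even_central_binomial_le[of k] assms by (simp add: power_mult)
next
  case False
  then obtain k where k: "n = Suc (2 * k)" by (metis oddE Suc_eq_plus1)
  define c where "c = real (n choose (n div 2))"
  have "real (2 * Suc k choose Suc k) = 2 * c"
    unfolding c_def using arg_cong[OF two_times_odd_central_binomial[of k], of real] k by simp
  then have "(2 * c) ^ 2 * pi * real (Suc k) \<le> 16 ^ Suc k"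
    using even_central_binomial_le[of "Suc k"] by simp
  moreover have "(16::real) ^ k = 4 ^ (2 * k)" by (simp add: power_mult)
  ultimately have "4 * (c ^ 2 * pi * (real k + 1)) \<le> 16 * 4 ^ (2 * k)"
    by (simp add: power_mult_distrib algebra_simps)
  then have "c ^ 2 * pi * (2 * real k + 2) \<le> 2 * 4 ^ n"
    by (simp add: k algebra_simps)
  moreover have "c ^ 2 * pi * real n \<le> c ^ 2 * pi * (2 * real k + 2)"
    by (intro mult_left_mono) (simp_all add: k)
  ultimately show ?thesis by (simp add: c_def)
qed

text \<open>The quotient is \<open>2 * (2 * k + 1) / (k + 1)\<close>, which reaches 3 at
  \<open>k = 1\<close> and increases.\<close>

lemma even_central_binomial_growth:
  assumes "k \<ge> 1"
  shows "3 * (2 * k choose k) \<le> 2 * Suc k choose Suc k"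
proof -
  have "Suc k * (3 * (2 * k choose k)) \<le> 2 * (2 * k + 1) * (2 * k choose k)"
    using assms by (simp add: algebra_simps)
  also have "\<dots> = Suc k * (2 * Suc k choose Suc k)"
    by (rule central_binomial_Suc[symmetric])
  finally show ?thesis using mult_le_cancel1 by blast
qed

lemma central_binomial_growth:
  assumes "n \<ge> 2"
  shows "3 * (n choose (n div 2)) \<le> (n + 2) choose ((n + 2) div 2)"
proof (cases "even n")
  case True
  then obtain k where k: "n = 2 * k" by blast
  then show ?thesis using even_central_binomial_growth[of k] assms by simp
next
  case False
  then obtain k where k: "n = Suc (2 * k)" by (metis oddE Suc_eq_plus1)
  have "2 * (3 * (Suc (2 * k) choose k)) \<le> 2 * (Suc (2 * Suc k) choose Suc k)"
    using even_central_binomial_growth[of "Suc k"] two_times_odd_central_binomial[of k]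
      two_times_odd_central_binomial[of "Suc k"] by linarith
  then show ?thesis by (simp add: k)
qed

text \<open>This precision makes the case \<open>n = 3\<close> of the upper estimate come out
  exactly: \<open>3 / 2 * 79 / 50 + 0.63 = 3\<close>.\<close>

lemma log_2_3_lower: "79 / 50 \<le> log 2 (3::real)"
proof -
  have "log 2 (2 ^ 79) \<le> log 2 (3 ^ 50 :: real)"
    by (subst log_le_cancel_iff) simp_all
  then have "79 * log 2 2 \<le> 50 * log 2 (3::real)"
    by (simp only: log_nat_power zero_less_numeral of_nat_numeral)
  then show ?thesis by simp
qed

text \<open>Induction in steps of two from 3 and 4: the factor 3 adds at least 2.37 on the right
  against 2 on the left.\<close>

lemma le_log_central_binomial:
  assumes "n \<ge> 3"
  shows "real n \<le> 3 / 2 * log 2 (real (n choose (n div 2))) + 0.63"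
  using assms
proof (induction n rule: less_induct)
  case (less n)
  consider "n = 3" | "n = 4" | m where "n = m + 2" "m \<ge> 3"
  proof (cases "n \<le> 4")
    case True
    then show ?thesis using less.prems that(1,2) by linarith
  next
    case False
    then show ?thesis by (intro that(3)[of "n - 2"]) simp_all
  qed
  then show ?case
  proof cases
    case 1
    have "(3::nat) choose 1 = 3" by simp
    then show ?thesis using 1 log_2_3_lower by simp
  next
    case 2
    have "(4::nat) choose 2 = 6" by (simp add: numeral_eq_Suc)
    moreover have "log 2 (6::real) = 1 + log 2 3"
      using log_mult[of 2 3 2] by simp
    moreover from this log_2_3_lower have "4 \<le> 3 / 2 * log 2 (6::real) + 63 / 100" by linarith
    ultimately show ?thesis using 2 by simp
  next
    case 3
    have pos: "0 < real (m choose (m div 2))" by simp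
    have "log 2 3 + log 2 (real (m choose (m div 2))) = log 2 (3 * real (m choose (m div 2)))"
      by (rule log_mult_pos[symmetric]) (use pos in simp_all)
    also have "\<dots> \<le> log 2 (real (n choose (n div 2)))"
    proof -
      have "3 * (m choose (m div 2)) \<le> n choose (n div 2)"
        using central_binomial_growth[of m] 3 by simp
      then have "3 * real (m choose (m div 2)) \<le> real (n choose (n div 2))" by linarith
      then show ?thesis using pos by (subst log_le_cancel_iff) linarith+
    qed
    finally have "log 2 3 + log 2 (real (m choose (m div 2))) \<le> log 2 (real (n choose (n div 2)))" .
    moreover have "real m \<le> 3 / 2 * log 2 (real (m choose (m div 2))) + 0.63"
      using less.IH[of m] 3 by simp
    moreover have "real n = real m + 2" using 3 by simp
    ultimately show ?thesis using log_2_3_lower by linarith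
  qed
qed

theorem lemma1:
  shows "VC (axis_halfspaces :: (real ^ 'd) set set)
           = enat (Max {n::nat. n \<ge> 1 \<and> n choose (n div 2) \<le> CARD('d)})
       \<and> (CARD('d) \<ge> 3 \<longrightarrow>
           ereal (log 2 (real CARD('d)) + (log 2 pi - 1) / 2)
             \<le> ereal_of_enat (VC (axis_halfspaces :: (real ^ 'd) set set))
         \<and> ereal_of_enat (VC (axis_halfspaces :: (real ^ 'd) set set))
             \<le> ereal (3 / 2 * log 2 (real CARD('d)) + 0.63))"
proof -
  define d where "d = CARD('d)"
  define S where "S = {n::nat. n \<ge> 1 \<and> n choose (n div 2) \<le> d}"
  define v where "v = Max S"
  have VC: "VC (axis_halfspaces :: (real ^ 'd) set set) = enat v"
    using VC_axis_halfspaces[where 'd = 'd] by (simp add: v_def S_def d_def)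
  have "log 2 (real d) + (log 2 pi - 1) / 2 \<le> real v \<and> real v \<le> 3 / 2 * log 2 (real d) + 0.63"
    if "d \<ge> 3"
  proof -
    have fin: "finite S" and ne: "S \<noteq> {}"
      using central_binomial_le_finite_nonempty[of d] that unfolding S_def by auto
    have "3 \<in> S" using that by (simp add: S_def)
    then have v3: "v \<ge> 3" using fin by (simp add: v_def)
    have "v \<in> S" using Max_in[OF fin ne] by (simp add: v_def)
    then have "v choose (v div 2) \<le> d" by (simp add: S_def)
    then have "log 2 (real (v choose (v div 2))) \<le> log 2 (real d)"
      using that by (subst log_le_cancel_iff) auto
    then have upper: "real v \<le> 3 / 2 * log 2 (real d) + 0.63"
      using le_log_central_binomial[OF v3] by simp
    \<comment> \<open>The lower estimate comes from maximality: \<open>d\<close> is less than the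
      central coefficient of \<open>Suc v\<close>.\<close>
    have "Suc v \<notin> S" using Max_ge[OF fin, of "Suc v"] by (auto simp: v_def)
    then have "d \<le> Suc v choose (Suc v div 2)" by (simp add: S_def del: binomial_Suc_Suc)
    \<comment> \<open>Since \<open>Suc v\<close> is at least 4, this factor 4 cancels the surplus
      one in \<open>4 ^ Suc v\<close>.\<close>
    then have "real d ^ 2 * pi * 4 \<le> real (Suc v choose (Suc v div 2)) ^ 2 * pi * real (Suc v)"
      using v3 by (intro mult_mono power_mono) (simp_all del: binomial_Suc_Suc)
    also have "\<dots> \<le> 2 * 4 ^ Suc v" by (rule central_binomial_upper_bound) simp
    finally have "real d ^ 2 * pi \<le> 2 * 4 ^ v" by (simp add: mult.commute)
    then have "log 2 (real d ^ 2 * pi) \<le> log 2 (2 * 4 ^ v)"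
      using that by (subst log_le_cancel_iff) auto
    moreover have "log 2 (real d ^ 2 * pi) = 2 * log 2 (real d) + log 2 pi"
      using that by (simp add: log_mult log_nat_power)
    moreover have "log 2 (2 * 4 ^ v) = 1 + 2 * real v"
    proof -
      have "(2::real) * 4 ^ v = 2 ^ (1 + 2 * v)" by (simp add: power_mult)
      then show ?thesis by (simp only: log_pow_cancel)
    qed
    ultimately have "log 2 (real d) + (log 2 pi - 1) / 2 \<le> real v" by (simp add: field_simps)
    with upper show ?thesis by blast
  qed
  then show ?thesis
    using VC by (simp add: v_def S_def d_def)
qed

end
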